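(* Assume the PETC system (see context) is globally exponentially stable (GES) and $a$ is a constant with $0<a<1$ such that every solution of it satisfies $V(\xi(t_{i+1}))\le aV(\xi(t_i))$ for all $i\in\mathbb{N}_0$. Let $0<r<1$ and $N:=\lceil\log_a(r)\rceil$. Then $$f^*=\max_{\sigma=k_1\cdots k_m\in\mathcal{X}^{\mathrm{S'}}}\ \frac{|\sigma|}{h\sum_{i=1}^{m}k_i}$$ (where $|\sigma|=m$ is the length of $\sigma$) is an upper bound for the average triggering frequency of the PETC system; i.e., for every initial state the sampling times satisfy $\limsup_{i\to\infty} i/t_i\le f^*$.
   Context: Plant and PETC. Let $A\in\mathbb{R}^{n_x\times n_x}$, $B\in\mathbb{R}^{n_x\times n_u}$, $K_{\mathrm{c}}\in\mathbb{R}^{n_u\times n_x}$ ($n_x\ge1$), $h>0$, $\bar k\in\mathbb{N}$ ($\bar k\ge1$), and let $Q\in\mathbb{R}^{2n_x\times 2n_x}$ be symmetric. The plant is $\dot\xi(t)=A\xi(t)+BK_{\mathrm{c}}\hat\xi(t)$, $\xi(0)=\hat\xi(0)=x_0$, with zero-order hold $\hat\xi(t)=\xi(t_i)$ for $t\in[t_i,t_{i+1})$, $t_0=0$. For $k\in\mathbb{N}$ put $M(k)=e^{Ahk}+\int_0^{hk}e^{A\tau}\,d\tau\,BK_{\mathrm{c}}$ and $N(k)=\begin{bmatrix}M(k)\\ I\end{bmatrix}^{\mathsf T}Q\begin{bmatrix}M(k)\\ I\end{bmatrix}$. The discrete inter-event time is $\kappa(x)=\min\{k\in\{1,\dots,\bar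 k\}: x^{\mathsf T}N(k)x>0\text{ or }k=\bar k\}$. The PETC system is the plant with $t_{i+1}=t_i+h\kappa(\xi(t_i))$. It is GES if there are $M<\infty$, $b>0$ such that $|\xi(t)|\le Me^{-bt}|\xi(0)|$ for all $t\ge0$ and all initial states. $V(x)=x^{\mathsf T}Px$ with $P$ symmetric positive definite. $\underline{k}:=\min\{k\in\{1,\dots,\bar k\}: N(k)\text{ is not negative semidefinite}\}$ (and $\underline k:=\bar k$ if there is no such $k$); $K:=\{\underline k,\dots,\bar k\}$. $K^m$ is the set of sequences of length $m$ with entries in $K$, and $\mathbb{K}_N:=\bigcup_{i=1}^NK^i\cup\{\varepsilon\}$, $\varepsilon$ the empty sequence. Put $\mathcal{X}_0=\{x\in\mathbb{R}^{n_x}:V(x)\le1\}$, $\mathcal{X}_{\mathrm{P}}=\{x:V(x)\le r\}$. Let $\mathcal{K}_k=\{x\in\mathcal{X}_0:x^{\mathsf T}N(k)x>0\}$ for $k<\bar k$, $\mathcal{K}_{\bar k}=\mathcal{X}_0$, and $\mathcal{Q}_k=\mathcal{K}_k\cap\bigcap_{j=\underline k}^{k-1}(\mathcal{X}_0\setminus\mathcal{K}_j)$ (just $\mathcal{K}_k$ if $k=\underline k$). For $x\in\mathbb{R}^{n_x}\setminus\{0\}$ and $k_1\cdots k_m\in\mathbb{K}_N$, $m\ge1$, set $(x,k_1\cdots k_m)\in\mathcal{R}_{\mathrm{S'}}$ iff $z:=x/\sqrt{V(x)}$ satisfies: $z\in\mathcal{X}_0$, $z\in\mathcal{Q}_{k_1}$,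 $M(k_{i-1})\cdots M(k_1)z\in\mathcal{Q}_{k_i}$ for $i=2,\dots,m$, $z\notin\mathcal{X}_{\mathrm{P}}$, $M(k_i)\cdots M(k_1)z\notin\mathcal{X}_{\mathrm{P}}$ for $i=1,\dots,m-1$, and $M(k_m)\cdots M(k_1)z\in\mathcal{X}_{\mathrm{P}}$. $\mathcal{X}^{\mathrm{S'}}:=\{\sigma\in\mathbb{K}_N:(x,\sigma)\in\mathcal{R}_{\mathrm{S'}}\text{ for some }x\in\mathbb{R}^{n_x}\setminus\{0\}\}$. *)

theory Defs
  imports "HOL-Analysis.Analysis"
begin

text \<open>The product \<open>*\<close> on \<open>real^'n^'n\<close> is componentwise and the type carries no
  normed-algebra structure, so the library's \<open>exp\<close> does not give the matrix exponential.
  It is introduced here by its power series, over the matrix product \<open>**\<close>.\<close>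

primrec matrix_power :: "real^'n^'n \<Rightarrow> nat \<Rightarrow> real^'n^'n" where
  "matrix_power A 0 = mat 1"
| "matrix_power A (Suc n) = A ** matrix_power A n"

definition matrix_exp :: "real^'n^'n \<Rightarrow> real^'n^'n" where
  "matrix_exp A = (\<Sum>n. matrix_power A n /\<^sub>R fact n)"

definition quad_form :: "real^'n^'n \<Rightarrow> real^'n \<Rightarrow> real" where
  "quad_form S x = x \<bullet> (S *v x)"

definition sym_pos_def :: "real^'n^'n \<Rightarrow> bool" where
  "sym_pos_def S \<longleftrightarrow> transpose S = S \<and> (\<forall>x. x \<noteq> 0 \<longrightarrow> quad_form S x > 0)"

text \<open>Only applied to symmetric matrices.\<close>

definition neg_semidef :: "real^'n^'n \<Rightarrow> bool" where
  "neg_semidef S \<longleftrightarrow> (\<forall>x. quad_form S x \<le> 0)"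

definition stack_rows :: "real^'n^'n \<Rightarrow> real^'n^'n \<Rightarrow> real^'n^('n + 'n)" where
  "stack_rows S T = (\<chi> i. case i of Inl j \<Rightarrow> S $ j | Inr j \<Rightarrow> T $ j)"

context
  fixes A :: "real^'n^'n" and B :: "real^'m^'n" and Kc :: "real^'n^'m"
    and h :: real and Q :: "real^('n + 'n)^('n + 'n)" and kbar :: nat
    and P :: "real^'n^'n" and r :: real
begin

definition M_mat :: "nat \<Rightarrow> real^'n^'n" where
  "M_mat k = matrix_exp ((h * real k) *\<^sub>R A)
     + integral {0..h * real k} (\<lambda>\<tau>. matrix_exp (\<tau> *\<^sub>R A)) ** B ** Kc"

definition N_mat :: "nat \<Rightarrow> real^'n^'n" where
  "N_mat k = transpose (stack_rows (M_mat k) (mat 1)) ** Q ** stack_rows (M_mat k) (mat 1)"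

definition kappa :: "real^'n \<Rightarrow> nat" where
  "kappa x = Min {k \<in> {1..kbar}. quad_form (N_mat k) x > 0 \<or> k = kbar}"

text \<open>\<open>\<xi>\<close> is the plant state, \<open>\<xi>h\<close> the held sample, \<open>t\<close> the sequence of sampling times;
  \<open>\<xi>\<close> and \<open>\<xi>h\<close> are only constrained on nonnegative times. At a sampling instant the
  differential equation is meant as a right derivative.\<close>

definition petc_solution ::
    "real^'n \<Rightarrow> (real \<Rightarrow> real^'n) \<Rightarrow> (real \<Rightarrow> real^'n) \<Rightarrow> (nat \<Rightarrow> real) \<Rightarrow> bool" where
  "petc_solution x0 \<xi> \<xi>h t \<longleftrightarrow>
     \<xi> 0 = x0 \<and> \<xi>h 0 = x0 \<and> t 0 = 0 \<and>
     (\<forall>i. t (Suc i) = t i + h * real (kappa (\<xi> (t i)))) \<and>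
     (\<forall>i. \<forall>s\<in>{t i..<t (Suc i)}. \<xi>h s = \<xi> (t i)) \<and>
     continuous_on {0..} \<xi> \<and>
     (\<forall>i. \<forall>s\<in>{t i..<t (Suc i)}.
        (\<xi> has_vector_derivative (A *v \<xi> s + B *v (Kc *v \<xi>h s)))
          (at s within {t i..<t (Suc i)}))"

definition petc_GES :: bool where
  "petc_GES \<longleftrightarrow> (\<exists>C b. b > 0 \<and> (\<forall>x0 \<xi> \<xi>h t. petc_solution x0 \<xi> \<xi>h t \<longrightarrow>
     (\<forall>s\<ge>0. norm (\<xi> s) \<le> C * exp (- b * s) * norm (\<xi> 0))))"

definition k_low :: nat where
  "k_low = (if \<exists>k\<in>{1..kbar}. \<not> neg_semidef (N_mat k)
            then Min {k \<in> {1..kbar}. \<not> neg_semidef (N_mat k)} else kbar)"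

definition K_seqs :: "nat \<Rightarrow> nat list set" where
  "K_seqs N = (\<Union>i\<in>{1..N}. {\<sigma>. length \<sigma> = i \<and> set \<sigma> \<subseteq> {k_low..kbar}}) \<union> {[]}"

definition X_0 :: "(real^'n) set" where
  "X_0 = {x. quad_form P x \<le> 1}"

definition X_P :: "(real^'n) set" where
  "X_P = {x. quad_form P x \<le> r}"

definition K_set :: "nat \<Rightarrow> (real^'n) set" where
  "K_set k = (if k < kbar then {x \<in> X_0. quad_form (N_mat k) x > 0} else X_0)"

definition Q_set :: "nat \<Rightarrow> (real^'n) set" where
  "Q_set k = K_set k \<inter> (\<Inter>j\<in>{k_low..<k}. X_0 - K_set j)"

text \<open>\<open>M_run [k\<^sub>1, \<dots>, k\<^sub>i] z\<close> is \<open>M(k\<^sub>i) \<dots> M(k\<^sub>1) z\<close>.\<close>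

definition M_run :: "nat list \<Rightarrow> real^'n \<Rightarrow> real^'n" where
  "M_run \<sigma> z = fold (\<lambda>k y. M_mat k *v y) \<sigma> z"

text \<open>Lists are indexed from 0, so \<open>\<sigma> ! i\<close> is \<open>k\<^sub>i\<^sub>+\<^sub>1\<close>.\<close>

definition R_S' :: "nat \<Rightarrow> ((real^'n) \<times> nat list) set" where
  "R_S' N = {(x, \<sigma>). x \<noteq> 0 \<and> \<sigma> \<in> K_seqs N \<and> \<sigma> \<noteq> [] \<and>
     (let z = x /\<^sub>R sqrt (quad_form P x) in
        z \<in> X_0 \<and> z \<in> Q_set (\<sigma> ! 0) \<and>
        (\<forall>i\<in>{1..<length \<sigma>}. M_run (take i \<sigma>) z \<in> Q_set (\<sigma> ! i)) \<and>
        z \<notin> X_P \<and>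
        (\<forall>i\<in>{1..<length \<sigma>}. M_run (take i \<sigma>) z \<notin> X_P) \<and>
        M_run \<sigma> z \<in> X_P)}"

definition X_S' :: "nat \<Rightarrow> nat list set" where
  "X_S' N = {\<sigma> \<in> K_seqs N. \<exists>x. x \<noteq> 0 \<and> (x, \<sigma>) \<in> R_S' N}"

definition f_star :: "nat \<Rightarrow> real" where
  "f_star N = Max ((\<lambda>\<sigma>. real (length \<sigma>) / (h * real (sum_list \<sigma>))) ` X_S' N)"

end

end

theory Submission imports Defs begin

text \<open>By variation of constants, sampling turns the PETC system into the positively homogeneous map
  \<open>x \<mapsto> M(\<kappa>(x)) x\<close>, along which \<open>V\<close> contracts by the factor \<open>a\<close> per step. From a
  nonzero sample the first entry into the sublevel set \<open>V \<le> r V(x)\<close> happens after some \<open>m \<le> N\<close>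
  steps because \<open>a\<^sup>N \<le> r\<close>, and the inter-event times up to then form a word of \<open>X_S'\<close>. Restarting
  at the entry point splits the sampling times into blocks of at most \<open>N\<close> events, each of frequency
  at most \<open>f*\<close>, so \<open>i \<le> f* t\<^sub>i + N\<close>. Once the state is zero every inter-event time is \<open>kbar\<close>,
  the smallest frequency any word can have.\<close>

section \<open>Matrix products as bounded bilinear maps\<close>

lemma bounded_bilinear_matrix_matrix_mult:
  "bounded_bilinear ((**) :: real^'n^'m \<Rightarrow> real^'p^'n \<Rightarrow> real^'p^'m)"
  unfolding bilinear_conv_bounded_bilinear [symmetric] bilinear_def
  by (auto intro!: linearI
      simp: matrix_matrix_mult_def vec_eq_iff algebra_simps sum.distrib sum_distrib_left)

lemma bounded_bilinear_matrix_vector_mult: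
  "bounded_bilinear ((*v) :: real^'n^'m \<Rightarrow> real^'n \<Rightarrow> real^'m)"
  unfolding bilinear_conv_bounded_bilinear [symmetric] bilinear_def
  by (auto intro!: linearI
      simp: matrix_vector_mult_def vec_eq_iff algebra_simps sum.distrib sum_distrib_left)

interpretation mm: bounded_bilinear "(**) :: real^'n^'m \<Rightarrow> real^'p^'n \<Rightarrow> real^'p^'m"
  by (rule bounded_bilinear_matrix_matrix_mult)

interpretation mv: bounded_bilinear "(*v) :: real^'n^'m \<Rightarrow> real^'n \<Rightarrow> real^'m"
  by (rule bounded_bilinear_matrix_vector_mult)

section \<open>The matrix exponential, its derivative and its integral\<close>

lemma matrix_power_commute: "A ** matrix_power A n = matrix_power A n ** A"
  by (induction n) (simp, metis matrix_mul_assoc matrix_power.simps(2))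

lemma matrix_power_scaleR: "matrix_power (s *\<^sub>R A) n = s ^ n *\<^sub>R matrix_power A n"
  by (induction n) (simp_all add: mm.scaleR_left mm.scaleR_right)

text \<open>Submultiplicativity up to the constant \<open>K\<close> bounds the powers geometrically,
  so a real exponential series dominates.\<close>

lemma summable_matrix_exp:
  fixes A :: "real^'n^'n"
  shows "summable (\<lambda>n. matrix_power A n /\<^sub>R fact n)"
proof -
  obtain K where K: "K > 0" "\<And>(X :: real^'n^'n) (Y :: real^'n^'n). norm (X ** Y) \<le> norm X * norm Y * K"
    using mm.pos_bounded by blast
  have b: "norm (matrix_power A n) \<le> (norm A * K) ^ n * norm (mat 1 :: real^'n^'n)" for n
  proof (induction n)
    case (Suc n)
    have "norm (matrix_power A (Suc n)) \<le> norm A * norm (matrix_power A n) * K"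
      using K(2)[of A "matrix_power A n"] by simp
    also have "\<dots> \<le> norm A * ((norm A * K) ^ n * norm (mat 1 :: real^'n^'n)) * K"
      using Suc K(1) by (intro mult_right_mono mult_left_mono) auto
    finally show ?case by (simp add: algebra_simps)
  qed simp
  show ?thesis
  proof (rule summable_comparison_test')
    show "summable (\<lambda>n. (norm A * K) ^ n /\<^sub>R fact n * norm (mat 1 :: real^'n^'n))"
      by (intro summable_mult2 summable_exp_generic)
    show "norm (matrix_power A n /\<^sub>R fact n) \<le> (norm A * K) ^ n /\<^sub>R fact n * norm (mat 1 :: real^'n^'n)"
      if "n \<ge> 0" for n
      using b[of n] by (simp add: field_simps)
  qed
qed

lemma summable_matrix_exp_scaleR: "summable (\<lambda>n. (s ^ n / fact n) *\<^sub>R matrix_power A n)"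
  using summable_matrix_exp[of "s *\<^sub>R A"] by (simp add: matrix_power_scaleR divide_inverse mult.commute)

lemma matrix_exp_scaleR: "matrix_exp (s *\<^sub>R A) = (\<Sum>n. (s ^ n / fact n) *\<^sub>R matrix_power A n)"
  by (simp add: matrix_exp_def matrix_power_scaleR divide_inverse mult.commute)

lemma matrix_exp_zero: "matrix_exp 0 = mat 1"
proof -
  have "(\<Sum>n. matrix_power 0 n /\<^sub>R fact n) = (\<Sum>n\<in>{0}. matrix_power (0 :: real^'n^'n) n /\<^sub>R fact n)"
    by (rule suminf_finite) (auto simp: gr0_conv_Suc mm.zero_left)
  then show ?thesis by (simp add: matrix_exp_def)
qed

lemma matrix_exp_commute: "A ** matrix_exp (s *\<^sub>R A) = matrix_exp (s *\<^sub>R A) ** A"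
  unfolding matrix_exp_scaleR
  by (simp add: bounded_linear.suminf [OF mm.bounded_linear_right summable_matrix_exp_scaleR]
    bounded_linear.suminf [OF mm.bounded_linear_left summable_matrix_exp_scaleR]
    mm.scaleR_left mm.scaleR_right matrix_power_commute)

text \<open>Each entry is an everywhere convergent real power series with coefficients
  \<open>c n\<close>, so it may be differentiated termwise; \<open>diffs c\<close> gives the entries
  of the claimed derivative.\<close>

lemma matrix_exp_has_vector_derivative:
  "((\<lambda>s. matrix_exp (s *\<^sub>R A)) has_vector_derivative A ** matrix_exp (s *\<^sub>R A)) (at s within S)"
proof -
  have entry: "((\<lambda>s. matrix_exp (s *\<^sub>R A) $ i $ j) has_field_derivative
      (A ** matrix_exp (s *\<^sub>R A)) $ i $ j) (at s within S)" for i j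
  proof -
    have bl: "bounded_linear (\<lambda>X :: real^'a^'a. X $ i $ j)"
      by (intro bounded_linear_compose [OF bounded_linear_vec_nth bounded_linear_vec_nth])
    define c where "c n = matrix_power A n $ i $ j / fact n" for n
    have c: "(\<lambda>n. ((y ^ n / fact n) *\<^sub>R matrix_power A n) $ i $ j) = (\<lambda>n. c n * y ^ n)" for y
      by (auto simp: c_def)
    have sm: "summable (\<lambda>n. c n * y ^ n)" for y
      using bounded_linear.summable [OF bl summable_matrix_exp_scaleR[of y A]] unfolding c .
    have e: "matrix_exp (y *\<^sub>R A) $ i $ j = (\<Sum>n. c n * y ^ n)" for y
      unfolding matrix_exp_scaleR bounded_linear.suminf [OF bl summable_matrix_exp_scaleR] c ..
    have "A ** matrix_exp (s *\<^sub>R A) = (\<Sum>n. (s ^ n / fact n) *\<^sub>R matrix_power A (Suc n))"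
      unfolding matrix_exp_scaleR
      by (simp add: bounded_linear.suminf [OF mm.bounded_linear_right summable_matrix_exp_scaleR]
          mm.scaleR_right)
    moreover have "summable (\<lambda>n. (s ^ n / fact n) *\<^sub>R matrix_power A (Suc n))"
      using bounded_linear.summable [OF mm.bounded_linear_right[of A] summable_matrix_exp_scaleR[of s A]]
      by (simp add: mm.scaleR_right)
    ultimately have "(A ** matrix_exp (s *\<^sub>R A)) $ i $ j
        = (\<Sum>n. ((s ^ n / fact n) *\<^sub>R matrix_power A (Suc n)) $ i $ j)"
      using bounded_linear.suminf [OF bl] by metis
    also have "\<dots> = (\<Sum>n. diffs c n * s ^ n)"
      by (intro suminf_cong) (simp add: diffs_def c_def field_simps del: of_nat_Suc)
    finally show ?thesis
      unfolding e using termdiffs_strong_converges_everywhere [OF sm]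
      by (auto intro: has_field_derivative_at_within)
  qed
  show ?thesis
    unfolding has_vector_derivative_def
    by (subst has_derivative_componentwise_within)
      (use entry in \<open>auto simp: Basis_vec_def inner_axis has_field_derivative_def mult.commute [of _ "_ $ _ $ _"]\<close>)
qed

lemma continuous_on_matrix_exp: "continuous_on S (\<lambda>s. matrix_exp (s *\<^sub>R A))"
  by (rule continuous_on_vector_derivative) (rule matrix_exp_has_vector_derivative)

lemma integral_matrix_exp_has_vector_derivative:
  assumes "s \<in> {0..T}"
  shows "((\<lambda>u. integral {0..u} (\<lambda>\<tau>. matrix_exp (\<tau> *\<^sub>R A))) has_vector_derivative matrix_exp (s *\<^sub>R A))
    (at s within {0..T})"
  using assms by (intro integral_has_vector_derivative continuous_on_matrix_exp)

text \<open>Fundamental theorem of calculus for the exponential, with the constant factor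
  \<open>A\<close> pulled out of the integral.\<close>

lemma mult_integral_matrix_exp:
  assumes "0 \<le> s"
  shows "A ** integral {0..s} (\<lambda>\<tau>. matrix_exp (\<tau> *\<^sub>R A)) = matrix_exp (s *\<^sub>R A) - mat 1"
proof -
  have "((\<lambda>\<tau>. A ** matrix_exp (\<tau> *\<^sub>R A)) has_integral matrix_exp (s *\<^sub>R A) - matrix_exp (0 *\<^sub>R A)) {0..s}"
    using assms by (intro fundamental_theorem_of_calculus matrix_exp_has_vector_derivative)
  then have "integral {0..s} (\<lambda>\<tau>. A ** matrix_exp (\<tau> *\<^sub>R A)) = matrix_exp (s *\<^sub>R A) - mat 1"
    by (simp add: integral_unique matrix_exp_zero)
  moreover have "integral {0..s} ((**) A \<circ> (\<lambda>\<tau>. matrix_exp (\<tau> *\<^sub>R A)))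
      = A ** integral {0..s} (\<lambda>\<tau>. matrix_exp (\<tau> *\<^sub>R A))"
    by (intro integral_linear mm.bounded_linear_right integrable_continuous_real continuous_on_matrix_exp)
  ultimately show ?thesis by (simp add: o_def)
qed

section \<open>Variation of constants for constant input\<close>

lemma variation_of_constants_has_vector_derivative:
  fixes A :: "real^'n^'n" and x b :: "real^'n"
  assumes s: "s \<in> {0..T}"
  defines "y \<equiv> \<lambda>s. matrix_exp (s *\<^sub>R A) *v x + integral {0..s} (\<lambda>\<tau>. matrix_exp (\<tau> *\<^sub>R A)) *v b"
  shows "(y has_vector_derivative A *v y s + b) (at s within {0..T})"
proof -
  have "(y has_vector_derivative
      (A ** matrix_exp (s *\<^sub>R A)) *v x + matrix_exp (s *\<^sub>R A) *v b) (at s within {0..T})"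
    unfolding y_def
    by (intro has_vector_derivative_add
        bounded_linear.has_vector_derivative [OF mv.bounded_linear_left]
        matrix_exp_has_vector_derivative integral_matrix_exp_has_vector_derivative s)
  moreover have "matrix_exp (s *\<^sub>R A) *v b = (A ** integral {0..s} (\<lambda>\<tau>. matrix_exp (\<tau> *\<^sub>R A))) *v b + b"
    using s by (simp add: mult_integral_matrix_exp mv.diff_left)
  ultimately show ?thesis
    by (simp add: y_def mv.add_right matrix_vector_mul_assoc add.assoc)
qed

text \<open>Comparing the two end values of a quantity that is constant along solutions forces the
  explicit formula. The derivative is assumed only in the open interval because the held input may
  jump at sampling instants.\<close>

lemma variation_of_constants_unique:
  fixes A :: "real^'n^'n"
  assumes T: "0 \<le> T" and cont: "continuous_on {t0..t0 + T} y"
    and deriv: "\<And>s. s \<in> {t0<..<t0 + T} \<Longrightarrow> (y has_vector_derivative A *v y s + b) (at s)"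
  shows "y (t0 + T) = matrix_exp (T *\<^sub>R A) *v y t0
    + integral {0..T} (\<lambda>\<tau>. matrix_exp (\<tau> *\<^sub>R A)) *v b"
proof -
  define E where "E u = matrix_exp (u *\<^sub>R A)" for u
  define G where "G u = integral {0..u} E" for u
  \<comment> \<open>Propagates \<open>y s\<close> with constant input from \<open>s\<close> to the end time, hence is constant along solutions.\<close>
  define g where "g s = E (t0 + T - s) *v y s + G (t0 + T - s) *v b" for s
  have contE: "continuous_on S E" for S
    using continuous_on_matrix_exp[of S A] by (simp add: E_def[abs_def])
  have G_deriv: "(G has_vector_derivative E s) (at s within {0..T})" if "s \<in> {0..T}" for s
    unfolding G_def[abs_def] E_def[abs_def] by (rule integral_matrix_exp_has_vector_derivative [OF that])
  have contG: "continuous_on {0..T} G"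
    by (rule continuous_on_vector_derivative) (rule G_deriv)
  have "continuous_on {t0..t0 + T} g"
    unfolding g_def
    by (intro continuous_on_add mv.continuous_on cont continuous_on_const
        continuous_on_compose2 [OF contE[of UNIV]] continuous_on_compose2 [OF contG] continuous_intros) auto
  moreover have "(g has_vector_derivative 0) (at s)" if s: "s \<in> {t0<..<t0 + T}" for s
  proof -
    have E': "(E has_vector_derivative A ** E (t0 + T - s)) (at (t0 + T - s))"
      unfolding E_def by (rule matrix_exp_has_vector_derivative)
    have G': "(G has_vector_derivative E (t0 + T - s)) (at (t0 + T - s))"
      using G_deriv[of "t0 + T - s"] at_within_Icc_at[of 0 "t0 + T - s" T] s by simp
    have d: "((\<lambda>s. t0 + T - s) has_vector_derivative -1) (at s)"
      by (auto intro!: derivative_eq_intros simp: has_real_derivative_iff_has_vector_derivative[symmetric])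
    have "((\<lambda>s. E (t0 + T - s)) has_vector_derivative - (A ** E (t0 + T - s))) (at s)"
      "((\<lambda>s. G (t0 + T - s)) has_vector_derivative - E (t0 + T - s)) (at s)"
      using vector_diff_chain_at [OF d E'] vector_diff_chain_at [OF d G'] by (simp_all add: o_def)
    then have "(g has_vector_derivative
        (E (t0 + T - s) *v (A *v y s + b) + (- (A ** E (t0 + T - s))) *v y s)
          + (- E (t0 + T - s)) *v b) (at s)"
      unfolding g_def
      by (intro has_vector_derivative_add mv.has_vector_derivative deriv s
          bounded_linear.has_vector_derivative [OF mv.bounded_linear_left])
    \<comment> \<open>\<open>A\<close> commutes with its exponential, so the terms in
      \<open>y s\<close> cancel, as do those in \<open>b\<close>.\<close>
    then show ?thesis
      unfolding E_def
      by (simp add: matrix_exp_commute mv.add_right mv.minus_left matrix_vector_mul_assoc)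
  qed
  ultimately have "((\<lambda>s. 0) has_integral g (t0 + T) - g t0) {t0..t0 + T}"
    using T by (intro fundamental_theorem_of_calculus_interior) auto
  then have "g (t0 + T) = g t0"
    using has_integral_unique [OF has_integral_0] by fastforce
  then show ?thesis
    by (simp add: g_def E_def G_def[abs_def] matrix_exp_zero E_def[abs_def] mv.zero_left)
qed

lemma quad_form_scaleR: "quad_form S (c *\<^sub>R x) = c\<^sup>2 * quad_form S x"
  by (simp add: quad_form_def matrix_vector_mult_scaleR power2_eq_square)

text \<open>Division by \<open>t i\<close> sends the additive constant to 0, so counting events up
  to a bounded error suffices.\<close>

lemma limsup_ratio_le:
  fixes t :: "nat \<Rightarrow> real"
  assumes bound: "\<And>i. real i \<le> f * t i + c" and t: "filterlim t at_top sequentially"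
  shows "limsup (\<lambda>i. ereal (real i / t i)) \<le> ereal f"
proof -
  have "eventually (\<lambda>i. 0 < t i) sequentially"
    using t by (rule filterlim_at_top_dense [THEN iffD1, rule_format])
  then have "eventually (\<lambda>i. ereal (real i / t i) \<le> ereal (f + c / t i)) sequentially"
  proof eventually_elim
    case (elim i)
    then have "real i / t i \<le> (f * t i + c) / t i"
      by (intro divide_right_mono bound) auto
    with elim show ?case by (simp add: add_divide_distrib)
  qed
  then have "limsup (\<lambda>i. ereal (real i / t i)) \<le> limsup (\<lambda>i. ereal (f + c / t i))"
    by (rule Limsup_mono)
  also have "(\<lambda>i. f + c / t i) \<longlonglongrightarrow> f + 0"
    by (intro tendsto_add tendsto_const tendsto_divide_0 [OF tendsto_const]
        filterlim_at_top_imp_at_infinity t)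
  then have "limsup (\<lambda>i. ereal (f + c / t i)) = ereal f"
    by (intro lim_imp_Limsup) auto
  finally show ?thesis .
qed

section \<open>The sampled dynamics and its inter-event words\<close>

context
  fixes A :: "real^'n^'n" and B :: "real^'m^'n" and Kc :: "real^'n^'m"
    and h :: real and Q :: "real^('n + 'n)^('n + 'n)" and kbar :: nat
begin

definition sample_step :: "real^'n \<Rightarrow> real^'n" where
  "sample_step x = M_mat A B Kc h (kappa A B Kc h Q kbar x) *v x"

text \<open>The plant trajectory over one hold interval, with \<open>x\<close> both initial state
  and held sample.\<close>

definition held_flow :: "real^'n \<Rightarrow> real \<Rightarrow> real^'n" where
  "held_flow x s = matrix_exp (s *\<^sub>R A) *v x
     + integral {0..s} (\<lambda>\<tau>. matrix_exp (\<tau> *\<^sub>R A)) *v (B *v (Kc *v x))"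

lemma held_flow_zero: "held_flow x 0 = x"
  by (simp add: held_flow_def matrix_exp_zero mv.zero_left)

lemma held_flow_M_mat: "held_flow x (h * real k) = M_mat A B Kc h k *v x"
  by (simp add: held_flow_def M_mat_def mv.add_left matrix_vector_mul_assoc matrix_mul_assoc)

lemma held_flow_has_vector_derivative:
  assumes "s \<in> {0..T}"
  shows "(held_flow x has_vector_derivative A *v held_flow x s + B *v (Kc *v x)) (at s within {0..T})"
  using variation_of_constants_has_vector_derivative [OF assms, of A x "B *v (Kc *v x)"]
  by (simp add: held_flow_def[abs_def])

text \<open>The word of the first \<open>m\<close> inter-event times from \<open>x\<close>, read off
  the discrete dynamics alone.\<close>

definition sample_seq :: "real^'n \<Rightarrow> nat \<Rightarrow> nat list" where
  "sample_seq x m =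
    map (\<lambda>j. kappa A B Kc h Q kbar ((sample_step ^^ j) x)) [0..<m]"

lemma length_sample_seq [simp]: "length (sample_seq x m) = m"
  by (simp add: sample_seq_def)

lemma sample_seq_nth [simp]:
  "i < m \<Longrightarrow> sample_seq x m ! i = kappa A B Kc h Q kbar ((sample_step ^^ i) x)"
  by (simp add: sample_seq_def)

lemma take_sample_seq [simp]: "i \<le> m \<Longrightarrow> take i (sample_seq x m) = sample_seq x i"
  by (simp add: sample_seq_def take_map)

lemma M_run_sample_seq: "M_run A B Kc h (sample_seq x m) x = (sample_step ^^ m) x"
  unfolding M_run_def
  by (induction m) (simp_all add: sample_seq_def sample_step_def [of "(sample_step ^^ _) x"])

text \<open>The trigger tests only the sign of a quadratic form, which scaling multiplies by the
  positive number \<open>c\<^sup>2\<close>.\<close>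

lemma kappa_scaleR: "c \<noteq> 0 \<Longrightarrow> kappa A B Kc h Q kbar (c *\<^sub>R x) = kappa A B Kc h Q kbar x"
  by (simp add: kappa_def quad_form_scaleR zero_less_mult_iff)

lemma sample_step_funpow_scaleR:
  "c \<noteq> 0 \<Longrightarrow> (sample_step ^^ i) (c *\<^sub>R x) = c *\<^sub>R (sample_step ^^ i) x"
  by (induction i) (simp_all add: sample_step_def kappa_scaleR matrix_vector_mult_scaleR)

lemma sample_seq_scaleR: "c \<noteq> 0 \<Longrightarrow> sample_seq (c *\<^sub>R x) m = sample_seq x m"
  by (simp add: sample_seq_def sample_step_funpow_scaleR kappa_scaleR)

text \<open>These are words of length at most \<open>N\<close> over a finite alphabet.\<close>

lemma finite_X_S': "finite (X_S' A B Kc h Q kbar P r N)"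
proof (rule finite_subset)
  show "X_S' A B Kc h Q kbar P r N \<subseteq> K_seqs A B Kc h Q kbar N"
    by (auto simp: X_S'_def)
  show "finite (K_seqs A B Kc h Q kbar N)"
    unfolding K_seqs_def
    using finite_lists_length_eq [of "{k_low A B Kc h Q kbar..kbar}"] by (auto simp: conj_commute)
qed

context
  assumes kbar: "kbar \<ge> 1"
begin

text \<open>The set minimised in \<open>kappa\<close> contains \<open>kbar\<close>, so the minimum
  is attained and every smaller candidate fails the test.\<close>

lemma kappa_characterization:
  "kappa A B Kc h Q kbar x \<in> {1..kbar}"
  "quad_form (N_mat A B Kc h Q (kappa A B Kc h Q kbar x)) x > 0 \<or> kappa A B Kc h Q kbar x = kbar"
  "1 \<le> j \<Longrightarrow> j < kappa A B Kc h Q kbar x \<Longrightarrow> quad_form (N_mat A B Kc h Q j) x \<le> 0"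
proof -
  let ?S = "{k \<in> {1..kbar}. quad_form (N_mat A B Kc h Q k) x > 0 \<or> k = kbar}"
  have "?S \<noteq> {}" using kbar by force
  then have "kappa A B Kc h Q kbar x \<in> ?S"
    unfolding kappa_def by (intro Min_in) auto
  then show 1: "kappa A B Kc h Q kbar x \<in> {1..kbar}"
    "quad_form (N_mat A B Kc h Q (kappa A B Kc h Q kbar x)) x > 0 \<or> kappa A B Kc h Q kbar x = kbar"
    by auto
  show "quad_form (N_mat A B Kc h Q j) x \<le> 0" if j: "1 \<le> j" "j < kappa A B Kc h Q kbar x"
  proof (rule ccontr)
    assume "\<not> ?thesis"
    then have "j \<in> ?S" using j 1(1) by auto
    then have "kappa A B Kc h Q kbar x \<le> j"
      unfolding kappa_def by (intro Min_le) auto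
    with j show False by simp
  qed
qed

text \<open>If the trigger fires at \<open>kappa x\<close>, the state \<open>x\<close> itself
  witnesses that the matrix there is not negative semidefinite; otherwise
  \<open>kappa x = kbar\<close>, which bounds \<open>k_low\<close> in any case.\<close>

lemma k_low_bounds:
  "1 \<le> k_low A B Kc h Q kbar" "k_low A B Kc h Q kbar \<le> kappa A B Kc h Q kbar x"
proof -
  let ?S = "{k \<in> {1..kbar}. \<not> neg_semidef (N_mat A B Kc h Q k)}"
  show "1 \<le> k_low A B Kc h Q kbar"
  proof (cases "?S = {}")
    case False
    then have "Min ?S \<in> ?S" by (intro Min_in) auto
    then show ?thesis using kbar by (auto simp: k_low_def)
  qed (use kbar in \<open>auto simp: k_low_def\<close>)
  show "k_low A B Kc h Q kbar \<le> kappa A B Kc h Q kbar x"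
  proof (cases "kappa A B Kc h Q kbar x \<in> ?S")
    case True
    then have "Min ?S \<le> kappa A B Kc h Q kbar x" by (intro Min_le) auto
    with True show ?thesis unfolding k_low_def by auto
  next
    case False
    then have kap: "kappa A B Kc h Q kbar x = kbar"
      using kappa_characterization(1,2)[of x] unfolding neg_semidef_def
      by (metis (mono_tags, lifting) mem_Collect_eq not_le)
    have "Min ?S \<le> kbar" if "\<exists>k\<in>{1..kbar}. \<not> neg_semidef (N_mat A B Kc h Q k)"
    proof -
      have "Min ?S \<in> ?S" using that by (intro Min_in) auto
      then show ?thesis by simp
    qed
    with kap show ?thesis by (auto simp only: k_low_def split: if_split)
  qed
qed

text \<open>All quadratic forms vanish at the origin, so the trigger never fires and the default
  \<open>kbar\<close> applies.\<close>

lemma kappa_zero: "kappa A B Kc h Q kbar 0 = kbar"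
  using kappa_characterization(2)[of 0] by (simp add: quad_form_def)

lemma set_sample_seq: "set (sample_seq x m) \<subseteq> {k_low A B Kc h Q kbar..kbar}"
  using kappa_characterization(1) k_low_bounds(2) by (auto simp: sample_seq_def)

lemma mem_Q_set_kappa:
  assumes "quad_form P x \<le> 1"
  shows "x \<in> Q_set A B Kc h Q kbar P (kappa A B Kc h Q kbar x)"
proof -
  have "x \<in> K_set A B Kc h Q kbar P (kappa A B Kc h Q kbar x)"
    using assms kappa_characterization(2) [of x] by (auto simp: K_set_def X_0_def)
  \<comment> \<open>Here \<open>j < kbar\<close>, so \<open>K_set\<close> at \<open>j\<close> is the
    genuine trigger set and not the default \<open>X_0\<close>.\<close>
  moreover have "x \<notin> K_set A B Kc h Q kbar P j"
    if "j \<in> {k_low A B Kc h Q kbar..<kappa A B Kc h Q kbar x}" for j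
    using that kappa_characterization(1) [where x = x] kappa_characterization(3) [where j = j and x = x]
      k_low_bounds(1)
    by (force simp: K_set_def)
  ultimately show ?thesis using assms by (auto simp: Q_set_def X_0_def)
qed

section \<open>Sampling a solution, and existence of solutions\<close>

context
  assumes h: "h > 0"
begin

text \<open>On a hold interval the equation is affine with constant input, so uniqueness identifies
  the state at its end.\<close>

lemma petc_solution_sample_step:
  assumes sol: "petc_solution A B Kc h Q kbar x0 \<xi> \<xi>h t"
  shows "0 \<le> t i" "\<xi> (t (Suc i)) = sample_step (\<xi> (t i))"
proof -
  have t0: "t 0 = 0" and tS: "\<And>i. t (Suc i) = t i + h * real (kappa A B Kc h Q kbar (\<xi> (t i)))"
    and held: "\<And>i s. s \<in> {t i..<t (Suc i)} \<Longrightarrow> \<xi>h s = \<xi> (t i)"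
    and cont: "continuous_on {0..} \<xi>"
    and ode: "\<And>i s. s \<in> {t i..<t (Suc i)} \<Longrightarrow>
        (\<xi> has_vector_derivative (A *v \<xi> s + B *v (Kc *v \<xi>h s))) (at s within {t i..<t (Suc i)})"
    using sol unfolding petc_solution_def by blast+
  have nn: "0 \<le> t i" for i
    by (induction i) (use t0 tS h in auto)
  show "0 \<le> t i" by (rule nn)
  let ?T = "h * real (kappa A B Kc h Q kbar (\<xi> (t i)))"
  have "\<xi> (t i + ?T) = matrix_exp (?T *\<^sub>R A) *v \<xi> (t i)
      + integral {0..?T} (\<lambda>\<tau>. matrix_exp (\<tau> *\<^sub>R A)) *v (B *v (Kc *v \<xi> (t i)))"
  proof (rule variation_of_constants_unique)
    show "0 \<le> ?T" using h by simp
    show "continuous_on {t i..t i + ?T} \<xi>"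
      using nn[of i] by (intro continuous_on_subset [OF cont]) auto
    fix s assume "s \<in> {t i<..<t i + ?T}"
    then have s: "s \<in> {t i<..<t (Suc i)}" by (simp add: tS)
    \<comment> \<open>Passing to the open interval turns the one-sided derivative into a two-sided
      one.\<close>
    then have "(\<xi> has_vector_derivative (A *v \<xi> s + B *v (Kc *v \<xi>h s))) (at s within {t i<..<t (Suc i)})"
      by (intro has_vector_derivative_within_subset [OF ode[of s i]]) auto
    with s show "(\<xi> has_vector_derivative A *v \<xi> s + B *v (Kc *v \<xi> (t i))) (at s)"
      by (simp add: at_within_open [of s "{t i<..<t (Suc i)}"] held[of s i])
  qed
  then show "\<xi> (t (Suc i)) = sample_step (\<xi> (t i))"
    by (simp add: tS sample_step_def held_flow_M_mat [symmetric] held_flow_def)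
qed

text \<open>A solution from every initial state lets a decay property of solutions be read as one of
  the map \<open>sample_step\<close>. It is glued from held flows on consecutive intervals.\<close>

lemma petc_solution_exists: "\<exists>\<xi> \<xi>h t. petc_solution A B Kc h Q kbar x0 \<xi> \<xi>h t"
proof -
  define x where "x i = (sample_step ^^ i) x0" for i
  define \<delta> where "\<delta> i = h * real (kappa A B Kc h Q kbar (x i))" for i
  define t where "t i = (\<Sum>j<i. \<delta> j)" for i
  \<comment> \<open>For \<open>s \<ge> 0\<close> this is the index of the hold interval containing
    \<open>s\<close>.\<close>
  define idx where "idx s = (LEAST i. s < t (Suc i))" for s
  define \<xi> where "\<xi> s = held_flow (x (idx s)) (s - t (idx s))" for s
  define \<xi>h where "\<xi>h s = x (idx s)" for s
  have tS: "t (Suc i) = t i + \<delta> i" for i by (simp add: t_def)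
  have \<delta>: "h \<le> \<delta> i" for i
    using h kappa_characterization(1)[of "x i"] by (simp add: \<delta>_def)
  have incr: "incseq t"
    by (rule incseq_SucI) (use tS \<delta> h in \<open>simp add: order_trans [OF less_imp_le]\<close>)
  \<comment> \<open>A dwell time of at least \<open>h\<close> keeps the sampling times from
    accumulating, so the intervals cover all nonnegative times.\<close>
  have t_ge: "h * real i \<le> t i" for i
  proof (induction i)
    case (Suc i) then show ?case using \<delta>[of i] by (simp add: tS algebra_simps)
  qed (simp add: t_def)
  have idx: "idx s = i" if "s \<in> {t i..<t (Suc i)}" for i s
    unfolding idx_def
  proof (rule Least_equality)
    fix j assume "s < t (Suc j)"
    with that have "t i < t (Suc j)" by simp
    then show "i \<le> j" using incseqD [OF incr, of "Suc j" i] by force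
  qed (use that in simp)
  have xS: "x (Suc i) = held_flow (x i) (\<delta> i)" for i
    by (simp add: x_def \<delta>_def held_flow_M_mat sample_step_def)
  have t_less: "t i < t (Suc i)" for i
    using tS[of i] \<delta>[of i] h by simp
  have \<xi>_samp: "\<xi> (t i) = x i" for i
    using t_less[of i] by (simp add: \<xi>_def idx[of "t i" i] held_flow_zero)
  \<comment> \<open>Neighbouring pieces agree at the shared endpoint, so the formula extends to the
    closed interval.\<close>
  have \<xi>_eq: "\<xi> s = held_flow (x i) (s - t i)" if "s \<in> {t i..t (Suc i)}" for i s
  proof (cases "s = t (Suc i)")
    case True then show ?thesis using \<xi>_samp[of "Suc i"] xS[of i] tS[of i] by simp
  next
    case False
    with that have "s \<in> {t i..<t (Suc i)}" by auto
    then show ?thesis by (simp add: \<xi>_def idx)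
  qed
  have deriv: "(\<xi> has_vector_derivative A *v \<xi> s + B *v (Kc *v x i)) (at s within {t i..t (Suc i)})"
    if s: "s \<in> {t i..t (Suc i)}" for i s
  proof -
    have "((\<lambda>s. s - t i) has_vector_derivative 1) (at s within {t i..t (Suc i)})"
      by (auto intro!: derivative_eq_intros simp: has_real_derivative_iff_has_vector_derivative[symmetric])
    moreover have "(held_flow (x i) has_vector_derivative A *v held_flow (x i) (s - t i) + B *v (Kc *v x i))
        (at (s - t i) within (\<lambda>s. s - t i) ` {t i..t (Suc i)})"
      using s held_flow_has_vector_derivative[of "s - t i" "t (Suc i) - t i" "x i"] by simp
    ultimately have "((\<lambda>s. held_flow (x i) (s - t i)) has_vector_derivative
        A *v \<xi> s + B *v (Kc *v x i)) (at s within {t i..t (Suc i)})"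
      using vector_diff_chain_within \<xi>_eq [OF s] by (fastforce simp: o_def)
    then show ?thesis
      by (rule has_vector_derivative_transform [OF s, rotated]) (use \<xi>_eq in auto)
  qed
  have cont_n: "continuous_on {0..t n} \<xi>" for n
  proof (induction n)
    case (Suc n)
    have "continuous_on {t n..t (Suc n)} \<xi>"
      by (rule continuous_on_vector_derivative) (rule deriv)
    with Suc have "continuous_on ({0..t n} \<union> {t n..t (Suc n)}) \<xi>"
      by (intro continuous_on_closed_Un) auto
    moreover have "0 \<le> t n" using t_ge[of n] h by (meson mult_nonneg_nonneg less_imp_le of_nat_0_le_iff order_trans)
    ultimately show ?case using t_less[of n] by (simp add: ivl_disj_un_two_touch)
  qed (simp add: t_def)
  have "continuous_on {0..} \<xi>"
    unfolding continuous_on_eq_continuous_within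
  proof
    fix s :: real assume s: "s \<in> {0..}"
    obtain n where "s < h * real n"
      using h reals_Archimedean3 by (metis mult.commute)
    then have n: "s < t n" using t_ge[of n] by simp
    then have "continuous (at s within {0..t n}) \<xi>"
      using cont_n[of n] s unfolding continuous_on_eq_continuous_within by auto
    \<comment> \<open>Continuity is local, and \<open>s\<close> lies strictly before
      \<open>t n\<close>.\<close>
    moreover have "at s within {0..t n} = at s within {0..}"
      by (rule at_within_nhd[of s "{..<t n}"]) (use n in auto)
    ultimately show "continuous (at s within {0..}) \<xi>" by (simp add: continuous_within)
  qed
  moreover have \<xi>h_eq: "\<xi>h s = x i" if "s \<in> {t i..<t (Suc i)}" for i s
    unfolding \<xi>h_def idx [OF that] ..
  moreover have "(\<xi> has_vector_derivative A *v \<xi> s + B *v (Kc *v \<xi>h s)) (at s within {t i..<t (Suc i)})"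
    if s: "s \<in> {t i..<t (Suc i)}" for i s
    unfolding \<xi>h_eq [OF s]
    by (rule has_vector_derivative_within_subset [OF deriv]) (use s in auto)
  moreover have "t 0 = 0" "x 0 = x0" by (simp_all add: t_def x_def)
  moreover from this have "\<xi>h 0 = x0" using t_less[of 0] by (subst \<xi>h_eq[of _ 0]) auto
  moreover have "\<xi> 0 = x0" using \<xi>_samp[of 0] \<open>t 0 = 0\<close> \<open>x 0 = x0\<close> by simp
  moreover have "t (Suc i) = t i + h * real (kappa A B Kc h Q kbar (x i))" for i
    by (simp only: tS \<delta>_def)
  ultimately have "petc_solution A B Kc h Q kbar x0 \<xi> \<xi>h t"
    unfolding petc_solution_def \<xi>_samp by (intro conjI allI ballI)
  then show ?thesis by blast
qed

text \<open>Letters are at least 1 and at most \<open>kbar\<close>. The lower bound is the frequency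
  of the system at rest, where every inter-event time is \<open>kbar\<close>.\<close>

lemma X_S'_ratio:
  assumes "\<sigma> \<in> X_S' A B Kc h Q kbar P r N"
  shows "0 < sum_list \<sigma>" "1 / (h * real kbar) \<le> real (length \<sigma>) / (h * real (sum_list \<sigma>))"
proof -
  have \<sigma>: "\<sigma> \<noteq> []" "set \<sigma> \<subseteq> {k_low A B Kc h Q kbar..kbar}"
    using assms by (auto simp: X_S'_def R_S'_def K_seqs_def)
  have le: "sum_list \<sigma> \<le> length \<sigma> * kbar"
  proof -
    have "sum_list (map (\<lambda>k. k) \<sigma>) \<le> sum_list (map (\<lambda>_. kbar) \<sigma>)"
      using \<sigma>(2) by (intro sum_list_mono) auto
    then show ?thesis by (simp add: sum_list_triv)
  qed
  have "hd \<sigma> \<in> set \<sigma>" using \<sigma>(1) by simp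
  moreover from this have "hd \<sigma> \<le> sum_list \<sigma>" by (intro member_le_sum_list) auto
  ultimately show pos: "0 < sum_list \<sigma>"
    using \<sigma>(2) k_low_bounds(1) by fastforce
  have "real (sum_list \<sigma>) \<le> real (length \<sigma>) * real kbar"
    using le by (metis of_nat_le_iff of_nat_mult)
  then show "1 / (h * real kbar) \<le> real (length \<sigma>) / (h * real (sum_list \<sigma>))"
    using h kbar pos by (simp add: divide_simps mult.commute)
qed

section \<open>Contraction and first entry into the sublevel set\<close>

context
  fixes P :: "real^'n^'n" and r a :: real and N :: nat
  assumes P: "sym_pos_def P" and a: "0 < a" "a < 1" and r: "0 < r" "r < 1" and N: "N = nat \<lceil>log a r\<rceil>"
    and decay: "\<And>x. quad_form P (sample_step x) \<le> a * quad_form P x"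
begin

text \<open>Powers of a base below 1 decrease in the exponent, so \<open>N \<ge> log a r\<close>
  gives \<open>a ^ N \<le> a powr log a r = r\<close>.\<close>

lemma power_N_le: "a ^ N \<le> r"
proof -
  have "log a r \<le> real N" unfolding N by linarith
  then have "a powr real N \<le> a powr log a r"
    using a by (intro powr_mono') auto
  also have "a powr log a r = r" using a r by simp
  finally show ?thesis using a by (simp add: powr_realpow)
qed

lemma quad_form_funpow_le: "quad_form P ((sample_step ^^ i) x) \<le> a ^ i * quad_form P x"
proof (induction i)
  case (Suc i)
  have "quad_form P ((sample_step ^^ Suc i) x)
      \<le> a * quad_form P ((sample_step ^^ i) x)"
    using decay by simp
  also have "\<dots> \<le> a * (a ^ i * quad_form P x)"
    using Suc a by (intro mult_left_mono) auto
  finally show ?case by simp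
qed simp

text \<open>Homogeneity allows normalising to \<open>V z = 1\<close> without changing the word,
  which is then cut at the first entry into \<open>V \<le> r\<close>.\<close>

lemma sample_seq_in_X_S':
  assumes x: "x \<noteq> 0"
  shows "\<exists>m\<in>{1..N}. sample_seq x m \<in> X_S' A B Kc h Q kbar P r N"
proof -
  let ?f = "sample_step"
  have Vx: "0 < quad_form P x" using P x by (simp add: sym_pos_def_def)
  define z where "z = x /\<^sub>R sqrt (quad_form P x)"
  have Vz: "quad_form P z = 1" using Vx by (simp add: z_def quad_form_scaleR power_inverse)
  have Vi: "quad_form P ((?f ^^ i) z) \<le> 1" for i
    using quad_form_funpow_le [of i z] power_le_one [of a i] a Vz by simp
  \<comment> \<open>The first entry time; minimality keeps all earlier samples outside
    \<open>X_P\<close>.\<close>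
  define m where "m = (LEAST i. quad_form P ((?f ^^ i) z) \<le> r)"
  have ex: "quad_form P ((?f ^^ N) z) \<le> r"
    using quad_form_funpow_le [of N z] power_N_le Vz by simp
  then have Vm: "quad_form P ((?f ^^ m) z) \<le> r"
    unfolding m_def by (rule LeastI)
  have "m \<le> N" using ex unfolding m_def by (rule Least_le)
  have before: "r < quad_form P ((?f ^^ i) z)" if "i < m" for i
    using not_less_Least [OF that [unfolded m_def]] by simp
  \<comment> \<open>The start has \<open>V z = 1 > r\<close>, so the word is nonempty.\<close>
  have "m \<noteq> 0"
  proof
    assume "m = 0"
    with Vm Vz r show False by simp
  qed
  with \<open>m \<le> N\<close> have m: "m \<in> {1..N}" by simp
  have seq: "sample_seq x m = sample_seq z m"
    using Vx by (simp add: z_def sample_seq_scaleR)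
  have "sample_seq z m \<in> K_seqs A B Kc h Q kbar N"
    unfolding K_seqs_def using m set_sample_seq by auto
  moreover have "sample_seq z m \<noteq> []" using m by (simp add: sample_seq_def)
  ultimately have "(x, sample_seq z m) \<in> R_S' A B Kc h Q kbar P r N"
    using x m Vm Vz before[of 0] before Vi mem_Q_set_kappa [OF Vi] mem_Q_set_kappa [OF Vi, of 0]
    unfolding R_S'_def mem_Collect_eq prod.case Let_def z_def [symmetric]
    by (auto simp: M_run_sample_seq X_0_def X_P_def not_le)
  then have "sample_seq z m \<in> X_S' A B Kc h Q kbar P r N"
    using x unfolding X_S'_def by (auto simp: R_S'_def)
  with m seq show ?thesis by (intro bexI [of _ m]) simp_all
qed

text \<open>The state space has positive dimension, so a coordinate vector supplies a word.\<close>

lemma X_S'_nonempty: "X_S' A B Kc h Q kbar P r N \<noteq> {}"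
proof -
  have "axis undefined 1 \<noteq> (0 :: real^'n)" by (simp add: axis_eq_0_iff)
  from sample_seq_in_X_S' [OF this] show ?thesis by blast
qed

text \<open>The first bound is cleared of its denominator so that it adds up over blocks; the second
  serves the zero state.\<close>

lemma f_star_ge:
  assumes "\<sigma> \<in> X_S' A B Kc h Q kbar P r N"
  shows "real (length \<sigma>) \<le> f_star A B Kc h Q kbar P r N * (h * real (sum_list \<sigma>))"
    "1 / (h * real kbar) \<le> f_star A B Kc h Q kbar P r N"
proof -
  have ratio: "real (length \<sigma>) / (h * real (sum_list \<sigma>)) \<le> f_star A B Kc h Q kbar P r N"
    unfolding f_star_def using assms finite_X_S' by (intro Max_ge) auto
  then show "real (length \<sigma>) \<le> f_star A B Kc h Q kbar P r N * (h * real (sum_list \<sigma>))"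
    using X_S'_ratio(1) [OF assms] h by (simp add: pos_divide_le_eq)
  show "1 / (h * real kbar) \<le> f_star A B Kc h Q kbar P r N"
    using X_S'_ratio(2) [OF assms] ratio by (rule order_trans)
qed

lemma f_star_nonneg: "0 \<le> f_star A B Kc h Q kbar P r N"
proof -
  obtain \<sigma> where "\<sigma> \<in> X_S' A B Kc h Q kbar P r N" using X_S'_nonempty by blast
  from f_star_ge(2) [OF this] show ?thesis
    using h by (meson divide_nonneg_nonneg less_imp_le mult_nonneg_nonneg of_nat_0_le_iff order_trans zero_le_one)
qed

section \<open>Blocks of events along a trajectory\<close>

context
  fixes x :: "nat \<Rightarrow> real^'n" and t :: "nat \<Rightarrow> real"
  assumes xS: "\<And>i. x (Suc i) = sample_step (x i)"
    and tS: "\<And>i. t (Suc i) = t i + h * real (kappa A B Kc h Q kbar (x i))"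
begin

lemma sample_time_add: "t (i + m) - t i = h * real (sum_list (sample_seq (x i) m))"
proof -
  have "x (i + j) = (sample_step ^^ j) (x i)" for j
    by (induction j) (simp_all add: xS)
  then show ?thesis
    by (induction m) (simp_all add: sample_seq_def tS algebra_simps)
qed

text \<open>A nonzero state runs until first entry, spelling a word of \<open>X_S'\<close>; at the
  zero state a single event, with gap \<open>h * kbar\<close>, is a block.\<close>

lemma sampling_block:
  "\<exists>m\<in>{1..N}. real m \<le> f_star A B Kc h Q kbar P r N * (t (i + m) - t i)"
proof (cases "x i = 0")
  case True
  obtain \<sigma> where \<sigma>: "\<sigma> \<in> X_S' A B Kc h Q kbar P r N" using X_S'_nonempty by blast
  \<comment> \<open>A nonempty word of length at most \<open>N\<close> exists, hence
    \<open>N \<ge> 1\<close>.\<close>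
  then have "1 \<in> {1..N}" by (auto simp: X_S'_def R_S'_def K_seqs_def)
  moreover have "real 1 \<le> f_star A B Kc h Q kbar P r N * (t (i + 1) - t i)"
    using f_star_ge(2) [OF \<sigma>] h kbar True by (simp add: tS kappa_zero divide_le_eq)
  ultimately show ?thesis by blast
next
  case False
  then obtain m where "m \<in> {1..N}" "sample_seq (x i) m \<in> X_S' A B Kc h Q kbar P r N"
    using sample_seq_in_X_S' by blast
  then show ?thesis using f_star_ge(1) [of "sample_seq (x i) m"] by (intro bexI [of _ m]) (simp_all add: sample_time_add)
qed

text \<open>Strong induction peels off one block at a time; the final incomplete stretch of fewer
  than \<open>N\<close> events is absorbed by the term \<open>N\<close>.\<close>

lemma sampling_count_le: "real n \<le> f_star A B Kc h Q kbar P r N * (t (i + n) - t i) + real N"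
proof (induction n arbitrary: i rule: less_induct)
  case (less n)
  show ?case
  proof (cases "n < N")
    case True
    moreover have "0 \<le> f_star A B Kc h Q kbar P r N * (t (i + n) - t i)"
      using f_star_nonneg h by (simp add: sample_time_add)
    ultimately show ?thesis by simp
  next
    case False
    obtain m where m: "m \<in> {1..N}" "real m \<le> f_star A B Kc h Q kbar P r N * (t (i + m) - t i)"
      using sampling_block by blast
    \<comment> \<open>Since \<open>1 \<le> m \<le> N \<le> n\<close>, the induction hypothesis
      applies to \<open>n - m\<close>, restarted at index \<open>i + m\<close>.\<close>
    then have "real (n - m) \<le> f_star A B Kc h Q kbar P r N * (t (i + m + (n - m)) - t (i + m)) + real N"
      using False by (intro less) auto
    with m False show ?thesis by (simp add: algebra_simps of_nat_diff)
  qed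
qed

text \<open>Consecutive sampling times are at least \<open>h\<close> apart.\<close>

lemma filterlim_sample_time: "filterlim t at_top sequentially"
proof (rule filterlim_at_top_mono)
  show "filterlim (\<lambda>i. t 0 + h * real i) at_top sequentially"
    using h by (intro filterlim_tendsto_add_at_top [OF tendsto_const]
        filterlim_tendsto_pos_mult_at_top [OF tendsto_const] filterlim_real_sequentially)
  have "t 0 + h * real i \<le> t i" for i
  proof (induction i)
    case (Suc i)
    have "h * 1 \<le> h * real (kappa A B Kc h Q kbar (x i))"
      using h kappa_characterization(1) [of "x i"] by (intro mult_left_mono) auto
    with Suc show ?case by (simp add: tS algebra_simps)
  qed simp
  then show "eventually (\<lambda>i. t 0 + h * real i \<le> t i) sequentially" by simp
qed

lemma limsup_sampling_frequency_le:
  assumes "t 0 = 0"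
  shows "limsup (\<lambda>i. ereal (real i / t i)) \<le> ereal (f_star A B Kc h Q kbar P r N)"
  using sampling_count_le [of _ 0] assms by (intro limsup_ratio_le filterlim_sample_time) auto

end

end

end

end

end

text \<open>Finiteness and nonemptiness belong to the conclusion because they make the
  \<open>Max\<close> in \<open>f_star\<close> an attained maximum.\<close>

theorem proposition4:
  fixes A :: "real^'n^'n" and B :: "real^'m^'n" and Kc :: "real^'n^'m"
    and h a r :: real and Q :: "real^('n + 'n)^('n + 'n)" and kbar N :: nat
    and P :: "real^'n^'n"
  assumes "h > 0" and "kbar \<ge> 1" and "transpose Q = Q" and "sym_pos_def P"
    and "petc_GES A B Kc h Q kbar"
    and "0 < a" and "a < 1"
    and "\<And>x0 \<xi> \<xi>h t i. petc_solution A B Kc h Q kbar x0 \<xi> \<xi>h t \<Longrightarrow>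
           quad_form P (\<xi> (t (Suc i))) \<le> a * quad_form P (\<xi> (t i))"
    and "0 < r" and "r < 1"
    and "N = nat \<lceil>log a r\<rceil>"
  shows "finite (X_S' A B Kc h Q kbar P r N) \<and> X_S' A B Kc h Q kbar P r N \<noteq> {} \<and>
    (\<forall>x0 \<xi> \<xi>h t. petc_solution A B Kc h Q kbar x0 \<xi> \<xi>h t \<longrightarrow>
       limsup (\<lambda>i. ereal (real i / t i)) \<le> ereal (f_star A B Kc h Q kbar P r N))"
proof -
  \<comment> \<open>Every \<open>x\<close> starts some solution, and its first sampling step carries
    the decay over to the map.\<close>
  have decay: "quad_form P (sample_step A B Kc h Q kbar x) \<le> a * quad_form P x" for x
  proof -
    obtain \<xi> \<xi>h t where sol: "petc_solution A B Kc h Q kbar x \<xi> \<xi>h t"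
      using petc_solution_exists [OF assms(2,1)] by blast
    then have "\<xi> (t 0) = x" by (simp add: petc_solution_def)
    then show ?thesis
      using assms(8) [OF sol, of 0] petc_solution_sample_step(2) [OF assms(2,1) sol, of 0] by simp
  qed
  note setting = assms(2,1,4,6,7,9,10,11) decay
  have "limsup (\<lambda>i. ereal (real i / t i)) \<le> ereal (f_star A B Kc h Q kbar P r N)"
    if sol: "petc_solution A B Kc h Q kbar x0 \<xi> \<xi>h t" for x0 \<xi> \<xi>h t
  proof (rule limsup_sampling_frequency_le [OF setting])
    show "\<xi> (t (Suc i)) = sample_step A B Kc h Q kbar (\<xi> (t i))" for i
      using petc_solution_sample_step(2) [OF assms(2,1) sol] .
  qed (use sol in \<open>simp_all add: petc_solution_def\<close>)
  then show ?thesis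
    using finite_X_S' X_S'_nonempty [OF setting] by blast
qed

end
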